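(* Consider Best-of-$(2k+1)$ games, $k\ge 1$, between players $A$ and $B$ with serve-winning probabilities $0<p<1$ and $0<q<1$, in which $A$ serves first. (i) The rule $TRb$ is strategy-vulnerable; that is, there exist $k\ge 1$ and $p,q\in(0,1)$ for which a Best-of-$(2k+1)$ game played under $TRb$ is not strategy-proof. (ii) The rules $SR$ and $CR$ are strategy-proof; that is, for all $k\geq 1$ and all $p,q\in(0,1)$, the Best-of-$(2k+1)$ game played under $SR$, and the one played under $CR$, are strategy-proof. (iii) The rule $TRa$ is strategy-proof whenever $p+q>1$; that is, for all $k\ge 1$ and all $p,q\in(0,1)$ with $p+q>1$, the Best-of-$(2k+1)$ game played under $TRa$ is strategy-proof.
   Context: Two players $A$ and $B$ play a sequence of points. On each point exactly one player is the server, and exactly one of the two players wins the point (and scores one point). When $A$ serves, $A$ wins the point with probability $p$ (and $B$ wins it with probability $1-p$); when $B$ serves, $B$ wins the point with probability $q$ (and $A$ wins it with probability $1-q$). Here $q$ is not an abbreviation for $1-p$; $p$ and $q$ are unrelated parameters. The results of the serves are independent. $A$ always serves the first point. A Best-of-$(2k+1)$ game (Win-by-One) ends as soon as one player has scored $k+1$ points, and that player wins the game. Serving rules after the first point: - $SR$ (Standard Rule): the server is the winner of the previous point. - $CR$ (Catch-Up Rule): the server is the loser of the previous point. - $TRa$: if the scores are unequal, the server is the player with the lower score; if the score is tied (after the first point), the server is the player who was ahead in points immediately prior to the tie. - $TRb$: if the scores are unequal, the server is the player with the lower score; if the score is tied (after the first point), the server is the player who was behind in points immediately prior to the tie. A state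 $(C,x,y)$ means that $C\in\{A,B\}$ is about to serve, $A$'s score is $x$ and $B$'s score is $y$; the game starts in state $(A,0,0)$, and a state with $x=k+1$ or $y=k+1$ is terminal (no further serve). Under each rule, the current state together with the winner of the next point determines the next state. For a player $P$, the win probability of $P$ from a state is the probability that $P$ wins the game when play continues from that state with all subsequent points played according to the probabilities above (it is $1$ or $0$ at terminal states). The game is strategy-proof if no player, whether serving or receiving, can ever benefit from deliberately losing a point: for every nonterminal state that can be reached from $(A,0,0)$ under the rule and for each player $P\in\{A,B\}$, the win probability of $P$ from the state that results if $P$ wins the next point is at least the win probability of $P$ from the state that results if $P$ loses the next point. A game that is not strategy-proof is strategy-vulnerable. *)

theory Defs
  imports "HOL-Probability.Probability_Mass_Function"
begin

datatype player = PlayerA | PlayerB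

fun opponent :: "player \<Rightarrow> player" where
  "opponent PlayerA = PlayerB"
| "opponent PlayerB = PlayerA"

text \<open>A state \<open>(C, x, y)\<close>: player \<open>C\<close> is about to serve, A has \<open>x\<close> points and B has \<open>y\<close> points.\<close>

type_synonym state = "player \<times> nat \<times> nat"

abbreviation start_state :: state where
  "start_state \<equiv> (PlayerA, 0, 0)"

fun score :: "player \<Rightarrow> state \<Rightarrow> nat" where
  "score PlayerA (c, x, y) = x"
| "score PlayerB (c, x, y) = y"

text \<open>A serving rule maps the state before a point and the winner of that point to the server
  of the following point.\<close>

type_synonym rule = "state \<Rightarrow> player \<Rightarrow> player"

definition SR :: rule where
  "SR s w = w"

definition CR :: rule where
  "CR s w = opponent w"

fun add_point :: "player \<Rightarrow> nat \<times> nat \<Rightarrow> nat \<times> nat" where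
  "add_point PlayerA (x, y) = (Suc x, y)"
| "add_point PlayerB (x, y) = (x, Suc y)"

text \<open>In the trailing rules \<open>(x, y)\<close> are the scores before the point and \<open>(x', y')\<close> those after it.
  If \<open>x' = y'\<close> then \<open>x \<noteq> y\<close>, so comparing \<open>x\<close> and \<open>y\<close> tells who was ahead just before the tie.\<close>

fun TRa :: rule where
  "TRa (c, x, y) w =
    (let (x', y') = add_point w (x, y) in
      if x' < y' then PlayerA
      else if y' < x' then PlayerB
      else if x > y then PlayerA else PlayerB)"

fun TRb :: rule where
  "TRb (c, x, y) w =
    (let (x', y') = add_point w (x, y) in
      if x' < y' then PlayerA
      else if y' < x' then PlayerB
      else if x < y then PlayerA else PlayerB)"

definition next_state :: "rule \<Rightarrow> state \<Rightarrow> player \<Rightarrow> state" where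
  "next_state R s w = (R s w, add_point w (snd s))"

text \<open>Reachable terminal states have a score equal to \<open>k + 1\<close>; the inequality only makes
  \<open>final_state\<close> below total on unreachable states.\<close>

definition terminal :: "nat \<Rightarrow> state \<Rightarrow> bool" where
  "terminal k s \<longleftrightarrow> score PlayerA s \<ge> k + 1 \<or> score PlayerB s \<ge> k + 1"

inductive reachable :: "rule \<Rightarrow> nat \<Rightarrow> state \<Rightarrow> bool" for R :: rule and k :: nat where
  start: "reachable R k start_state"
| step: "reachable R k s \<Longrightarrow> \<not> terminal k s \<Longrightarrow> reachable R k (next_state R s w)"

fun serve_prob :: "real \<Rightarrow> real \<Rightarrow> player \<Rightarrow> real" where
  "serve_prob p q PlayerA = p"
| "serve_prob p q PlayerB = q"

definition point_winner :: "real \<Rightarrow> real \<Rightarrow> player \<Rightarrow> player pmf" where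
  "point_winner p q c =
    map_pmf (\<lambda>server_wins. if server_wins then c else opponent c) (bernoulli_pmf (serve_prob p q c))"

text \<open>Law of the terminal state when play continues from a given state. Each point is drawn by a
  fresh \<open>bind_pmf\<close>, which is the independence of the serves.\<close>

function final_state :: "rule \<Rightarrow> nat \<Rightarrow> real \<Rightarrow> real \<Rightarrow> state \<Rightarrow> state pmf" where
  "final_state R k p q s =
    (if terminal k s then return_pmf s
     else bind_pmf (point_winner p q (fst s)) (\<lambda>w. final_state R k p q (next_state R s w)))"
  by pat_completeness auto
termination
proof (relation "Wellfounded.measure (\<lambda>(R, k, p, q, s). (k + 1 - score PlayerA s) + (k + 1 - score PlayerB s))")
  fix R :: rule and k :: nat and p q :: real and s :: state and w :: player
  assume "\<not> terminal k s"
  then show "((R, k, p, q, next_state R s w), (R, k, p, q, s))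
      \<in> Wellfounded.measure (\<lambda>(R, k, p, q, s). (k + 1 - score PlayerA s) + (k + 1 - score PlayerB s))"
    by (cases s; cases w) (auto simp: terminal_def next_state_def)
qed simp

declare final_state.simps [simp del]

definition win_prob :: "rule \<Rightarrow> nat \<Rightarrow> real \<Rightarrow> real \<Rightarrow> player \<Rightarrow> state \<Rightarrow> real" where
  "win_prob R k p q P s = measure_pmf.prob (final_state R k p q s) {t. score P t = k + 1}"

definition strategy_proof :: "rule \<Rightarrow> nat \<Rightarrow> real \<Rightarrow> real \<Rightarrow> bool" where
  "strategy_proof R k p q \<longleftrightarrow>
    (\<forall>s P. reachable R k s \<longrightarrow> \<not> terminal k s \<longrightarrow>
      win_prob R k p q P (next_state R s P) \<ge> win_prob R k p q P (next_state R s (opponent P)))"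

end

theory Submission
  imports Defs
begin

text \<open>
  Everything is measured by \<open>V s\<close>, the probability that A wins the game from state \<open>s\<close>; the win
  probability of B is its complement, so strategy-proofness follows once A's winning the next
  point never lowers \<open>V\<close>. Write \<open>sA\<close> and \<open>sB\<close> for the states after \<open>s\<close> in which A, respectively
  B, has won the next point. The goal is \<open>V (sB) \<le> V (sA)\<close>, by induction from the end of the game.

  Two mechanisms give this. All rules considered choose the next server without
  looking at the present one, so two states with the same score have the same successors and
  differ only in the probability with which A wins the next point; given the claim at that score,
  the server who is better for A in the next point is better for A in the game
  (\<open>win_prob_A_mono_server\<close>).

  The first mechanism (\<open>strategy_proof_by_exchange\<close>) is the chain
  \<open>V (sB) \<le> V (sBA) \<le> V (sAB) \<le> V (sA)\<close>. The outer steps are the induction hypothesis at \<open>sB\<close>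
  and \<open>sA\<close>. The states \<open>sBA\<close> and \<open>sAB\<close> have the same score, so the middle step holds if the server
  in \<open>sAB\<close> is at least as good for A as the one in \<open>sBA\<close>. This covers \<open>TRa\<close> and \<open>CR\<close> when
  \<open>p + q \<ge> 1\<close> (serving is an advantage), and \<open>SR\<close> when \<open>p + q \<le> 1\<close>.

  The second mechanism (\<open>strategy_proof_by_transfer\<close>) applies when the next server
  depends only on who wins the point. Transferring a point from B to A while keeping the server then
  helps A, because the two games can be played with the same point winners
  (\<open>win_prob_A_transfer_point\<close>). If moreover A's winning a point brings in the server who is
  better for A, both effects of winning the point are favourable. This covers \<open>SR\<close> when \<open>p + q \<ge> 1\<close> and
  \<open>CR\<close> when \<open>p + q \<le> 1\<close>.

  Under \<open>TRb\<close> a player who has fallen behind keeps the serve after equalising. In a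
  Best-of-3 game A therefore wins with probability \<open>p\<^sup>2\<close> after losing the first point and
  \<open>1 - q\<^sup>2\<close> after winning it, so losing is better for A as soon as \<open>p\<^sup>2 + q\<^sup>2 > 1\<close>.
\<close>

section \<open>Recursion for the win probabilities\<close>

fun A_point_prob :: "real \<Rightarrow> real \<Rightarrow> player \<Rightarrow> real" where
  "A_point_prob p q PlayerA = p"
| "A_point_prob p q PlayerB = 1 - q"

lemma terminal_iff: "terminal k (c, x, y) \<longleftrightarrow> k < x \<or> k < y"
  by (auto simp: terminal_def)

lemma next_state_A: "next_state R (c, x, y) PlayerA = (R (c, x, y) PlayerA, Suc x, y)"
  and next_state_B: "next_state R (c, x, y) PlayerB = (R (c, x, y) PlayerB, x, Suc y)"
  by (simp_all add: next_state_def)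

lemma win_prob_terminal:
  assumes "terminal k s"
  shows "win_prob R k p q P s = (if score P s = k + 1 then 1 else 0)"
  using assms by (simp add: win_prob_def final_state.simps[of R k p q s])

lemma prob_bind_bernoulli_pmf:
  assumes "0 \<le> b" "b \<le> 1"
  shows "measure_pmf.prob (bind_pmf (bernoulli_pmf b) f) X =
    b * measure_pmf.prob (f True) X + (1 - b) * measure_pmf.prob (f False) X"
proof -
  have "ennreal (measure_pmf.prob (bind_pmf (bernoulli_pmf b) f) X) =
      ennreal (b * measure_pmf.prob (f True) X + (1 - b) * measure_pmf.prob (f False) X)"
    using assms
    by (simp flip: measure_pmf.emeasure_eq_measure)
      (simp add: measure_pmf.emeasure_eq_measure ennreal_mult mult.commute)
  then show ?thesis using assms by (subst (asm) ennreal_inj) auto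
qed

lemma win_prob_step:
  assumes "0 < p" "p < 1" "0 < q" "q < 1" "\<not> terminal k s"
  shows "win_prob R k p q P s =
    A_point_prob p q (fst s) * win_prob R k p q P (next_state R s PlayerA) +
    (1 - A_point_prob p q (fst s)) * win_prob R k p q P (next_state R s PlayerB)"
  using assms
  by (cases "fst s")
    (simp_all add: win_prob_def final_state.simps[of R k p q s] point_winner_def bind_map_pmf
      prob_bind_bernoulli_pmf)

lemma win_prob_B:
  assumes pq: "0 < p" "p < 1" "0 < q" "q < 1" and "x \<le> Suc k" "y \<le> Suc k" "x \<le> k \<or> y \<le> k"
  shows "win_prob R k p q PlayerB (c, x, y) = 1 - win_prob R k p q PlayerA (c, x, y)"
  using assms(5-)
proof (induction "(Suc k - x) + (Suc k - y)" arbitrary: c x y rule: less_induct)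
  case less
  show ?case
  proof (cases "terminal k (c, x, y)")
    case True
    then show ?thesis using less.prems by (auto simp: win_prob_terminal terminal_iff)
  next
    case False
    then have xy: "x \<le> k" "y \<le> k" by (auto simp: terminal_iff)
    have "win_prob R k p q PlayerB (d, Suc x, y) = 1 - win_prob R k p q PlayerA (d, Suc x, y)"
      and "win_prob R k p q PlayerB (d, x, Suc y) = 1 - win_prob R k p q PlayerA (d, x, Suc y)" for d
      using xy by (auto intro!: less.hyps)
    then show ?thesis
      by (simp add: win_prob_step[OF pq False] next_state_A next_state_B)
        (simp add: algebra_simps)
  qed
qed

lemma strategy_proof_if_A_gains:
  assumes pq: "0 < p" "p < 1" "0 < q" "q < 1"
    and gain: "\<And>c x y. x \<le> k \<Longrightarrow> y \<le> k \<Longrightarrow>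
      win_prob R k p q PlayerA (next_state R (c, x, y) PlayerB)
        \<le> win_prob R k p q PlayerA (next_state R (c, x, y) PlayerA)"
  shows "strategy_proof R k p q"
  unfolding strategy_proof_def
proof (intro allI impI)
  fix s P
  assume "\<not> terminal k s"
  moreover obtain c x y where s: "s = (c, x, y)" by (cases s)
  ultimately have xy: "x \<le> k" "y \<le> k" by (auto simp: terminal_iff)
  show "win_prob R k p q P (next_state R s (opponent P)) \<le> win_prob R k p q P (next_state R s P)"
    using gain[OF xy, of c] xy
    by (cases P) (simp_all add: s next_state_A next_state_B win_prob_B[OF pq])
qed

lemma win_prob_A_won: "win_prob R k p q PlayerA (c, Suc k, y) = 1"
  by (simp add: win_prob_terminal terminal_iff)

lemma win_prob_A_lost: "x \<le> k \<Longrightarrow> win_prob R k p q PlayerA (c, x, Suc k) = 0"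
  by (simp add: win_prob_terminal terminal_iff)

lemma win_prob_le_1: "win_prob R k p q P s \<le> 1"
  by (simp add: win_prob_def)

lemma win_prob_nonneg: "0 \<le> win_prob R k p q P s"
  by (simp add: win_prob_def)

lemma mix_mono:
  fixes a b u v :: real
  assumes "a \<le> b" "u \<le> v"
  shows "a * v + (1 - a) * u \<le> b * v + (1 - b) * u"
proof -
  have "0 \<le> (b - a) * (v - u)" using assms by simp
  then show ?thesis by (simp add: algebra_simps)
qed

lemma A_point_prob_bounds:
  assumes "0 < p" "p < 1" "0 < q" "q < 1"
  shows "0 \<le> A_point_prob p q c" "A_point_prob p q c \<le> 1"
  using assms by (cases c; simp)+

section \<open>Comparing two servers at the same score\<close>

text \<open>If the rule ignores the present server, the two states have the same successors, and they only
  mix them with different weights.\<close>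

lemma win_prob_A_mono_server:
  assumes pq: "0 < p" "p < 1" "0 < q" "q < 1"
    and blind: "\<And>c c' x y w. R (c, x, y) w = R (c', x, y) w"
    and xy: "x \<le> k" "y \<le> k"
    and gain: "win_prob R k p q PlayerA (next_state R (c, x, y) PlayerB)
        \<le> win_prob R k p q PlayerA (next_state R (c, x, y) PlayerA)"
    and server: "A_point_prob p q c \<le> A_point_prob p q c'"
  shows "win_prob R k p q PlayerA (c, x, y) \<le> win_prob R k p q PlayerA (c', x, y)"
proof -
  have same: "next_state R (c', x, y) w = next_state R (c, x, y) w" for w
    using blind[of c' x y w c] by (simp add: next_state_def)
  have nt: "\<not> terminal k (d, x, y)" for d using xy by (simp add: terminal_iff)
  show ?thesis
    unfolding win_prob_step[OF pq nt] same fst_conv by (rule mix_mono[OF server gain])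
qed

section \<open>The exchange mechanism\<close>

text \<open>The chain \<open>V (sB) \<le> V (sBA) \<le> V (sAB) \<le> V (sA)\<close>. Its middle step uses the induction
  hypothesis two points later, at the common score of \<open>sBA\<close> and \<open>sAB\<close>.\<close>

theorem strategy_proof_by_exchange:
  assumes pq: "0 < p" "p < 1" "0 < q" "q < 1"
    and blind: "\<And>c c' x y w. R (c, x, y) w = R (c', x, y) w"
    and exchange: "\<And>s. A_point_prob p q (R (next_state R s PlayerB) PlayerA)
        \<le> A_point_prob p q (R (next_state R s PlayerA) PlayerB)"
  shows "strategy_proof R k p q"
proof (rule strategy_proof_if_A_gains[OF pq])
  let ?V = "win_prob R k p q PlayerA" and ?next = "next_state R"
  show "?V (?next (c, x, y) PlayerB) \<le> ?V (?next (c, x, y) PlayerA)"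
    if "x \<le> k" "y \<le> k" for c x y
    using that
  proof (induction "(k - x) + (k - y)" arbitrary: c x y rule: less_induct)
    case less
    let ?sA = "?next (c, x, y) PlayerA" and ?sB = "?next (c, x, y) PlayerB"
    consider "x = k" | "y = k" | "x < k" "y < k" using less.prems by linarith
    then show ?case
    proof cases
      case 1
      then show ?thesis by (simp add: next_state_A win_prob_A_won win_prob_le_1)
    next
      case 2
      then show ?thesis using less.prems by (simp add: next_state_B win_prob_A_lost win_prob_nonneg)
    next
      case 3
      obtain cA where sA: "?sA = (cA, Suc x, y)" by (simp add: next_state_A)
      obtain cB where sB: "?sB = (cB, x, Suc y)" by (simp add: next_state_B)
      have ntA: "\<not> terminal k ?sA" and ntB: "\<not> terminal k ?sB"
        using 3 by (simp_all add: sA sB terminal_iff)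
      have ihA: "?V (?next ?sA PlayerB) \<le> ?V (?next ?sA PlayerA)"
        unfolding sA using 3 by (intro less.hyps) auto
      have ihB: "?V (?next ?sB PlayerB) \<le> ?V (?next ?sB PlayerA)"
        unfolding sB using 3 by (intro less.hyps) auto
      note bounds = A_point_prob_bounds[OF pq]
      \<comment> \<open>The value of a state lies between the values of its two successors.\<close>
      have "?V ?sB \<le> ?V (?next ?sB PlayerA)"
        using mix_mono[OF bounds(2) ihB, of "fst ?sB"] by (simp add: win_prob_step[OF pq ntB])
      also have "?V (?next ?sB PlayerA) \<le> ?V (?next ?sA PlayerB)"
        using 3 exchange[of "(c, x, y)"] unfolding sA sB next_state_A next_state_B
        by (intro win_prob_A_mono_server[OF pq, where R = R] blind less.hyps) auto
      also have "?V (?next ?sA PlayerB) \<le> ?V ?sA"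
        using mix_mono[OF bounds(1) ihA, of "fst ?sA"] by (simp add: win_prob_step[OF pq ntA])
      finally show ?thesis .
    qed
  qed
qed

section \<open>The transfer mechanism\<close>

text \<open>Play both games with the same point winners until one of them ends: their servers always agree.
  The first end is either a win of A in the game where A holds the transferred point, or a win of B
  in the other game, and both are consistent with the inequality.\<close>

lemma win_prob_A_transfer_point:
  assumes pq: "0 < p" "p < 1" "0 < q" "q < 1"
    and winner_only: "\<And>s w. R s w = r w"
    and "x \<le> k" "y \<le> k"
  shows "win_prob R k p q PlayerA (c, x, Suc y) \<le> win_prob R k p q PlayerA (c, Suc x, y)"
  using assms(6-)
proof (induction "(k - x) + (k - y)" arbitrary: c x y rule: less_induct)
  case less
  let ?V = "win_prob R k p q PlayerA"
  consider "x = k" | "y = k" | "x < k" "y < k" using less.prems by linarith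
  then show ?case
  proof cases
    case 1
    then show ?thesis by (simp add: win_prob_A_won win_prob_le_1)
  next
    case 2
    then show ?thesis using less.prems by (simp add: win_prob_A_lost win_prob_nonneg)
  next
    case 3
    have nt: "\<not> terminal k (c, Suc x, y)" "\<not> terminal k (c, x, Suc y)"
      using 3 by (simp_all add: terminal_iff)
    have "?V (r PlayerA, Suc x, Suc y) \<le> ?V (r PlayerA, Suc (Suc x), y)"
      using 3 by (intro less.hyps) auto
    moreover have "?V (r PlayerB, x, Suc (Suc y)) \<le> ?V (r PlayerB, Suc x, Suc y)"
      using 3 by (intro less.hyps) auto
    ultimately show ?thesis
      using A_point_prob_bounds[OF pq, of c]
      by (simp add: win_prob_step[OF pq nt(1)] win_prob_step[OF pq nt(2)] next_state_A next_state_B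
          winner_only add_mono mult_left_mono)
  qed
qed

text \<open>Winning instead of losing the point is done in two moves: give A the better server while B still
  keeps the point, then transfer the point.\<close>

theorem strategy_proof_by_transfer:
  assumes pq: "0 < p" "p < 1" "0 < q" "q < 1"
    and winner_only: "\<And>s w. R s w = r w"
    and server: "A_point_prob p q (r PlayerB) \<le> A_point_prob p q (r PlayerA)"
  shows "strategy_proof R k p q"
proof (rule strategy_proof_if_A_gains[OF pq])
  let ?V = "win_prob R k p q PlayerA"
  show "?V (next_state R (c, x, y) PlayerB) \<le> ?V (next_state R (c, x, y) PlayerA)"
    if "x \<le> k" "y \<le> k" for c x y
    using that
  proof (induction "k - y" arbitrary: c x y rule: less_induct)
    case less
    show ?case
    proof (cases "y = k")
      case True
      then show ?thesis using less.prems by (simp add: next_state_B win_prob_A_lost win_prob_nonneg)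
    next
      case False
      have "?V (r PlayerB, x, Suc y) \<le> ?V (r PlayerA, x, Suc y)"
        using less.prems False server
        by (intro win_prob_A_mono_server[OF pq] less.hyps) (auto simp: winner_only)
      also have "\<dots> \<le> ?V (r PlayerA, Suc x, y)"
        using less.prems by (intro win_prob_A_transfer_point[OF pq winner_only])
      finally show ?thesis by (simp add: next_state_A next_state_B winner_only)
    qed
  qed
qed

section \<open>The four serving rules\<close>

lemma strategy_proof_SR:
  assumes pq: "0 < p" "p < 1" "0 < q" "q < 1"
  shows "strategy_proof SR k p q"
proof (cases "p + q \<le> 1")
  case True
  then show ?thesis by (intro strategy_proof_by_exchange[OF pq]) (simp_all add: SR_def)
next
  case False
  then show ?thesis
    by (intro strategy_proof_by_transfer[OF pq, where r = "\<lambda>w. w"]) (simp_all add: SR_def)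
qed

lemma strategy_proof_CR:
  assumes pq: "0 < p" "p < 1" "0 < q" "q < 1"
  shows "strategy_proof CR k p q"
proof (cases "p + q \<ge> 1")
  case True
  then show ?thesis by (intro strategy_proof_by_exchange[OF pq]) (simp_all add: CR_def)
next
  case False
  then show ?thesis
    by (intro strategy_proof_by_transfer[OF pq, where r = opponent]) (simp_all add: CR_def)
qed

text \<open>The orders AB and BA of two points lead to different servers only if they start from a tie. They then
  end in a tie, and under \<open>TRa\<close> the winner of the first of the two points, who was ahead, serves.\<close>

lemma strategy_proof_TRa:
  assumes pq: "0 < p" "p < 1" "0 < q" "q < 1" and "p + q \<ge> 1"
  shows "strategy_proof TRa k p q"
proof (rule strategy_proof_by_exchange[OF pq])
  show "A_point_prob p q (TRa (next_state TRa s PlayerB) PlayerA)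
      \<le> A_point_prob p q (TRa (next_state TRa s PlayerA) PlayerB)" for s
    using assms by (cases s) (auto simp: next_state_A next_state_B)
qed simp

lemma not_strategy_proof_TRb:
  assumes pq: "0 < p" "p < 1" "0 < q" "q < 1" and "p\<^sup>2 + q\<^sup>2 > 1"
  shows "\<not> strategy_proof TRb 1 p q"
proof
  let ?V = "win_prob TRb 1 p q PlayerA"
  assume "strategy_proof TRb 1 p q"
  then have "?V (next_state TRb start_state PlayerB) \<le> ?V (next_state TRb start_state PlayerA)"
    unfolding strategy_proof_def
    using reachable.start[of TRb 1] by (metis opponent.simps(1) terminal_iff not_less_zero)
  then have "?V (PlayerA, 0, 1) \<le> ?V (PlayerB, 1, 0)"
    by (simp add: next_state_A next_state_B)
  moreover have "?V (PlayerA, 0, 1) = p\<^sup>2"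
    by (simp add: win_prob_step[OF pq] win_prob_terminal terminal_iff next_state_A next_state_B
        power2_eq_square)
  moreover have "?V (PlayerB, 1, 0) = 1 - q\<^sup>2"
    by (simp add: win_prob_step[OF pq] win_prob_terminal terminal_iff next_state_A next_state_B
        power2_eq_square algebra_simps)
  ultimately show False using \<open>p\<^sup>2 + q\<^sup>2 > 1\<close> by linarith
qed

theorem theorem3:
  shows "(\<exists>(k::nat) (p::real) (q::real). k \<ge> 1 \<and> 0 < p \<and> p < 1 \<and> 0 < q \<and> q < 1 \<and>
            \<not> strategy_proof TRb k p q)
    \<and> (\<forall>(k::nat) (p::real) (q::real). k \<ge> 1 \<and> 0 < p \<and> p < 1 \<and> 0 < q \<and> q < 1 \<longrightarrow>
            strategy_proof SR k p q \<and> strategy_proof CR k p q)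
    \<and> (\<forall>(k::nat) (p::real) (q::real). k \<ge> 1 \<and> 0 < p \<and> p < 1 \<and> 0 < q \<and> q < 1 \<and> p + q > 1 \<longrightarrow>
            strategy_proof TRa k p q)"
proof (intro conjI)
  have "\<not> strategy_proof TRb 1 (9/10) (9/10)"
    by (rule not_strategy_proof_TRb) (simp_all add: power2_eq_square)
  then show "\<exists>(k::nat) (p::real) (q::real). k \<ge> 1 \<and> 0 < p \<and> p < 1 \<and> 0 < q \<and> q < 1 \<and>
      \<not> strategy_proof TRb k p q"
    by (intro exI[of _ "1::nat"] exI[of _ "9/10::real"]) simp
qed (auto intro: strategy_proof_SR strategy_proof_CR strategy_proof_TRa)

end
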